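(* Let $G$ be a finite group, let $I$ and $\Lambda$ be finite nonempty index sets, and let $P=(p_{\lambda i})$ be a $\Lambda\times I$ matrix with entries in $G$. The maximum size of a commutative subsemigroup of $\mathcal{M}[G;I,\Lambda;P]$ is equal to the maximum size of an abelian subgroup of $G$. Furthermore, the commutative subsemigroups of $\mathcal{M}[G;I,\Lambda;P]$ of maximum size are exactly the groups $\{i\}\times(p_{\lambda i}^{-1}H)\times\{\lambda\}$, where $i\in I$, $\lambda\in\Lambda$ and $H$ is an abelian subgroup of $G$ of maximum size.
   Context: The Rees matrix semigroup $\mathcal{M}[G;I,\Lambda;P]$ over the group $G$ is the set $I\times G\times\Lambda$ with multiplication $(i,x,\lambda)(j,y,\mu)=(i,xp_{\lambda j}y,\mu)$. For $g\in G$ and $H\subseteq G$, $gH=\{gh:h\in H\}$. *)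

theory Defs
  imports "HOL-Algebra.Coset"
begin

record 'a sgrp = "'a partial_object" +
  smult :: "['a, 'a] \<Rightarrow> 'a" (infixl \<open>\<star>\<index>\<close> 70)

locale carrier_semigroup =
  fixes S :: "('a, 'b) sgrp_scheme" (structure)
  assumes smult_closed: "\<lbrakk>x \<in> carrier S; y \<in> carrier S\<rbrakk> \<Longrightarrow> x \<star> y \<in> carrier S"
    and smult_assoc: "\<lbrakk>x \<in> carrier S; y \<in> carrier S; z \<in> carrier S\<rbrakk>
      \<Longrightarrow> (x \<star> y) \<star> z = x \<star> (y \<star> z)"

(* Subsemigroups are required to be nonempty. *)
definition subsemigroup :: "'a set \<Rightarrow> ('a, 'b) sgrp_scheme \<Rightarrow> bool" where
  "subsemigroup T S \<longleftrightarrow>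
     T \<subseteq> carrier S \<and> T \<noteq> {} \<and> (\<forall>x\<in>T. \<forall>y\<in>T. x \<star>\<^bsub>S\<^esub> y \<in> T)"

definition comm_subsemigroup :: "'a set \<Rightarrow> ('a, 'b) sgrp_scheme \<Rightarrow> bool" where
  "comm_subsemigroup T S \<longleftrightarrow>
     subsemigroup T S \<and> (\<forall>x\<in>T. \<forall>y\<in>T. x \<star>\<^bsub>S\<^esub> y = y \<star>\<^bsub>S\<^esub> x)"

definition abelian_subgroup_of :: "'a set \<Rightarrow> ('a, 'b) monoid_scheme \<Rightarrow> bool" where
  "abelian_subgroup_of H G \<longleftrightarrow> subgroup H G \<and> comm_group (G\<lparr>carrier := H\<rparr>)"

(* The entry of the sandwich matrix in row l and column j is P l j;
   only its values for l \<in> L and j \<in> I matter. *)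
definition rees_matrix_semigroup ::
  "('a, 'b) monoid_scheme \<Rightarrow> 'i set \<Rightarrow> 'l set \<Rightarrow> ('l \<Rightarrow> 'i \<Rightarrow> 'a) \<Rightarrow> ('i \<times> 'a \<times> 'l) sgrp" where
  "rees_matrix_semigroup G I L P =
     \<lparr>carrier = I \<times> carrier G \<times> L,
      smult = (\<lambda>(i, x, l) (j, y, m). (i, x \<otimes>\<^bsub>G\<^esub> P l j \<otimes>\<^bsub>G\<^esub> y, m))\<rparr>"

lemma carrier_semigroup_rees_matrix_semigroup:
  assumes "group G" "\<And>l i. l \<in> L \<Longrightarrow> i \<in> I \<Longrightarrow> P l i \<in> carrier G"
  shows "carrier_semigroup (rees_matrix_semigroup G I L P)"
proof -
  interpret group G by fact
  show ?thesis
    using assms(2) by unfold_locales (auto simp: rees_matrix_semigroup_def m_assoc)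
qed

(* A subset T of S regarded as a structure on its own, with the multiplication of S and
   a proposed identity element e. *)
definition restrict_monoid :: "('a, 'b) sgrp_scheme \<Rightarrow> 'a set \<Rightarrow> 'a \<Rightarrow> 'a monoid" where
  "restrict_monoid S T e = \<lparr>carrier = T, mult = smult S, one = e\<rparr>"

end

theory Submission
  imports Defs
begin

text \<open>
  In a product of two triples the outer coordinates are the first coordinate of the left factor
  and the last coordinate of the right factor. Two commuting triples therefore agree in both, so a
  commutative subsemigroup lives in a single block \<open>{i} \<times> G \<times> {l}\<close>. On this block, with
  \<open>p = P l i\<close>, the multiplication is \<open>x, y \<mapsto> x p y\<close>, and \<open>x \<mapsto> p x\<close> turns it into the
  multiplication of \<open>G\<close>. The commutative subsemigroups thus correspond to the nonempty commutative
  subsets of \<open>G\<close> that are closed under multiplication, and since \<open>G\<close> is finite these are the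
  abelian subgroups. Hence all commutative subsemigroups, not only the largest ones, have the form
  \<open>{i} \<times> p\<^sup>-\<^sup>1H \<times> {l}\<close> with \<open>H\<close> an abelian subgroup
  (\<open>comm_subsemigroup_rees_matrix_semigroup_iff\<close>); this set has as many elements as \<open>H\<close>, so
  both statements about maximum size follow by comparing cardinalities.
\<close>

lemma carrier_rees_matrix_semigroup [simp]:
  "carrier (rees_matrix_semigroup G I L P) = I \<times> carrier G \<times> L"
  by (simp add: rees_matrix_semigroup_def)

lemma smult_rees_matrix_semigroup [simp]:
  "smult (rees_matrix_semigroup G I L P) (i, x, l) (j, y, m) =
    (i, x \<otimes>\<^bsub>G\<^esub> P l j \<otimes>\<^bsub>G\<^esub> y, m)"
  by (simp add: rees_matrix_semigroup_def)

context group
begin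

text \<open>
  Left multiplication by an element \<open>a\<close> of \<open>H\<close> is an injective self-map of the finite set \<open>H\<close>,
  hence surjective. Solving \<open>a e = a\<close> in \<open>H\<close> gives the identity, and solving \<open>a b = \<one>\<close> the
  inverse of \<open>a\<close>.
\<close>

lemma finite_mult_closed_subgroup:
  assumes H: "H \<subseteq> carrier G" "finite H" "H \<noteq> {}"
    and closed: "\<And>x y. x \<in> H \<Longrightarrow> y \<in> H \<Longrightarrow> x \<otimes> y \<in> H"
  shows "subgroup H G"
proof -
  have solve: "\<exists>b\<in>H. a \<otimes> b = c" if a: "a \<in> H" and c: "c \<in> H" for a c
  proof -
    have "inj_on ((\<otimes>) a) H"
      using a H(1) by (intro inj_onI) (metis Units_eq Units_l_cancel subsetD)
    then have "(\<otimes>) a ` H = H"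
      using a closed H(2) by (intro endo_inj_surj) auto
    then show ?thesis
      using c by (metis imageE)
  qed
  obtain a where a: "a \<in> H"
    using H(3) by blast
  then obtain e where "e \<in> H" "a \<otimes> e = a"
    using solve by blast
  then have one: "\<one> \<in> H"
    using a H(1) l_cancel_one[of a e] by (auto simp: subset_iff)
  show ?thesis
  proof (rule subgroupI)
    show "inv x \<in> H" if x: "x \<in> H" for x
    proof -
      obtain b where b: "b \<in> H" "x \<otimes> b = \<one>"
        using solve x one by blast
      then show ?thesis
        using x H(1) inv_equality[of x b] inv_inv[of b] by (simp add: subset_iff)
    qed
  qed (use H closed in auto)
qed

lemma abelian_subgroup_of_iff:
  "abelian_subgroup_of H G \<longleftrightarrow>
    subgroup H G \<and> (\<forall>x\<in>H. \<forall>y\<in>H. x \<otimes> y = y \<otimes> x)"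
proof
  assume "abelian_subgroup_of H G"
  then have "subgroup H G" and comm: "comm_group (G\<lparr>carrier := H\<rparr>)"
    by (auto simp: abelian_subgroup_of_def)
  moreover from comm have "\<forall>x\<in>H. \<forall>y\<in>H. x \<otimes> y = y \<otimes> x"
    using comm_monoid.m_comm[of "G\<lparr>carrier := H\<rparr>"] by (auto simp: comm_group_def)
  ultimately show "subgroup H G \<and> (\<forall>x\<in>H. \<forall>y\<in>H. x \<otimes> y = y \<otimes> x)"
    by blast
next
  assume H: "subgroup H G \<and> (\<forall>x\<in>H. \<forall>y\<in>H. x \<otimes> y = y \<otimes> x)"
  then interpret H: group "G\<lparr>carrier := H\<rparr>"
    using subgroup.subgroup_is_group is_group by blast
  show "abelian_subgroup_of H G"
    unfolding abelian_subgroup_of_def using H H.group_comm_groupI by auto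
qed

lemma card_rees_block:
  assumes "p \<in> carrier G" "H \<subseteq> carrier G"
  shows "card ({i} \<times> (inv p <# H) \<times> {l}) = card H"
proof -
  have "inj_on ((\<otimes>) (inv p)) H"
    using assms by (intro inj_onI) (metis Units_eq Units_l_cancel inv_closed subsetD)
  moreover have "inv p <# H = (\<otimes>) (inv p) ` H"
    by (auto simp: l_coset_def)
  ultimately show ?thesis
    by (simp add: card_cartesian_product card_image)
qed

text \<open>
  The sandwich entry cancels one of the two factors \<open>p\<^sup>-\<^sup>1\<close>, so that \<open>h \<mapsto> (i, p\<^sup>-\<^sup>1h, l)\<close>
  is multiplicative.
\<close>

lemma smult_rees_block:
  assumes "P l i \<in> carrier G" "h \<in> carrier G" "k \<in> carrier G"
  shows "smult (rees_matrix_semigroup G I L P)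
      (i, inv (P l i) \<otimes> h, l) (i, inv (P l i) \<otimes> k, l) = (i, inv (P l i) \<otimes> (h \<otimes> k), l)"
proof -
  have "inv (P l i) \<otimes> h \<otimes> P l i \<otimes> (inv (P l i) \<otimes> k) = inv (P l i) \<otimes> (h \<otimes> k)"
    using assms by (simp add: m_assoc inv_solve_left' flip: m_assoc[of "P l i" "inv (P l i)"])
  then show ?thesis
    by simp
qed

text \<open>
  The bijection \<open>h \<mapsto> (i, p\<^sup>-\<^sup>1h, l)\<close> carries the group structure of \<open>H\<close> over; the identity is
  the image of \<open>\<one>\<close>.
\<close>

lemma group_rees_block:
  assumes p: "P l i \<in> carrier G" and H: "subgroup H G"
  shows "group (restrict_monoid (rees_matrix_semigroup G I L P)
      ({i} \<times> (inv (P l i) <# H) \<times> {l}) (i, inv (P l i) \<otimes> \<one>, l))"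
    (is "group ?M")
proof -
  interpret H: subgroup H G by fact
  define M where "M = ?M"
  define f where "f = (\<lambda>h. (i, inv (P l i) \<otimes> h, l))"
  have carr: "carrier M = f ` H"
    by (auto simp: M_def restrict_monoid_def f_def l_coset_def)
  have mult: "f h \<otimes>\<^bsub>M\<^esub> f k = f (h \<otimes> k)" if "h \<in> H" "k \<in> H" for h k
    using that p smult_rees_block[of P l i h k I L] by (simp add: M_def restrict_monoid_def f_def)
  have one: "\<one>\<^bsub>M\<^esub> = f \<one>"
    by (simp add: M_def restrict_monoid_def f_def)
  have "group M"
  proof (rule groupI)
    show "\<exists>y\<in>carrier M. y \<otimes>\<^bsub>M\<^esub> x = \<one>\<^bsub>M\<^esub>" if x: "x \<in> carrier M" for x
    proof -
      obtain h where h: "h \<in> H" "x = f h"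
        using x unfolding carr by blast
      then have "f (inv h) \<otimes>\<^bsub>M\<^esub> x = \<one>\<^bsub>M\<^esub>"
        by (simp add: mult one)
      then show ?thesis
        using h unfolding carr by blast
    qed
  qed (auto simp: carr one mult m_assoc)
  then show ?thesis
    by (simp add: M_def)
qed

text \<open>
  From left to right \<open>H\<close> is recovered as \<open>pA\<close>, where \<open>A\<close> is the set of middle coordinates of \<open>T\<close>.
  Finiteness of \<open>G\<close> is essential: without it \<open>pA\<close> is only closed under multiplication, as for the
  positive integers inside the additive group of integers.
\<close>

theorem comm_subsemigroup_rees_matrix_semigroup_iff:
  assumes fin: "finite (carrier G)"
    and P: "\<And>l i. l \<in> L \<Longrightarrow> i \<in> I \<Longrightarrow> P l i \<in> carrier G"
  shows "comm_subsemigroup T (rees_matrix_semigroup G I L P) \<longleftrightarrow>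
    (\<exists>i\<in>I. \<exists>l\<in>L. \<exists>H. abelian_subgroup_of H G \<and> T = {i} \<times> (inv (P l i) <# H) \<times> {l})"
    (is "?comm T \<longleftrightarrow> _")
proof
  assume T: "?comm T"
  then have sub: "T \<subseteq> I \<times> carrier G \<times> L" and ne: "T \<noteq> {}"
    and closed: "\<And>x y. x \<in> T \<Longrightarrow> y \<in> T \<Longrightarrow> smult (rees_matrix_semigroup G I L P) x y \<in> T"
    and comm: "\<And>x y. x \<in> T \<Longrightarrow> y \<in> T \<Longrightarrow>
      smult (rees_matrix_semigroup G I L P) x y = smult (rees_matrix_semigroup G I L P) y x"
    by (simp_all add: comm_subsemigroup_def subsemigroup_def)
  obtain i a l where ial: "(i, a, l) \<in> T"
    using ne by auto
  then have i: "i \<in> I" and l: "l \<in> L"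
    using sub by auto
  note p = P[OF l i]
  define A where "A = {x. (i, x, l) \<in> T}"
  \<comment> \<open>The product of \<open>(j, y, m)\<close> with \<open>(i, a, l)\<close> has outer coordinates \<open>j\<close> and \<open>l\<close> in one
    order and \<open>i\<close> and \<open>m\<close> in the other.\<close>
  have T_eq: "T = {i} \<times> A \<times> {l}"
  proof -
    have "j = i \<and> m = l" if "(j, y, m) \<in> T" for j y m
      using comm[OF that ial] by simp
    then show ?thesis
      by (auto simp: A_def)
  qed
  have A: "A \<subseteq> carrier G"
    using sub by (auto simp: A_def)
  have A_closed: "x \<otimes> P l i \<otimes> y \<in> A" if "x \<in> A" "y \<in> A" for x y
    using closed[of "(i, x, l)" "(i, y, l)"] that by (simp add: A_def)
  have A_comm: "x \<otimes> P l i \<otimes> y = y \<otimes> P l i \<otimes> x" if "x \<in> A" "y \<in> A" for x y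
    using comm[of "(i, x, l)" "(i, y, l)"] that by (simp add: A_def)
  define H where "H = P l i <# A"
  have H: "H \<subseteq> carrier G"
    using A p by (simp add: H_def l_coset_subset_G)
  have mult: "(P l i \<otimes> x) \<otimes> (P l i \<otimes> y) = P l i \<otimes> (x \<otimes> P l i \<otimes> y)"
    if "x \<in> A" "y \<in> A" for x y
    using that A p by (simp add: m_assoc subset_iff)
  have "subgroup H G"
  proof (rule finite_mult_closed_subgroup)
    show "H \<noteq> {}"
      using ial by (auto simp: H_def A_def l_coset_def)
    show "x \<otimes> y \<in> H" if "x \<in> H" "y \<in> H" for x y
      using that mult A_closed by (fastforce simp: H_def l_coset_def)
  qed (use H fin finite_subset in auto)
  moreover have "x \<otimes> y = y \<otimes> x" if "x \<in> H" "y \<in> H" for x y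
    using that mult A_comm by (auto simp: H_def l_coset_def)
  ultimately have "abelian_subgroup_of H G"
    by (simp add: abelian_subgroup_of_iff)
  moreover have "inv (P l i) <# H = A"
    using A p by (simp add: H_def lcos_m_assoc lcos_mult_one)
  ultimately show
    "\<exists>i\<in>I. \<exists>l\<in>L. \<exists>H. abelian_subgroup_of H G \<and> T = {i} \<times> (inv (P l i) <# H) \<times> {l}"
    using i l T_eq by blast
next
  assume "\<exists>i\<in>I. \<exists>l\<in>L. \<exists>H. abelian_subgroup_of H G \<and> T = {i} \<times> (inv (P l i) <# H) \<times> {l}"
  then obtain i l H where i: "i \<in> I" and l: "l \<in> L" and H: "subgroup H G"
    and comm: "\<And>x y. x \<in> H \<Longrightarrow> y \<in> H \<Longrightarrow> x \<otimes> y = y \<otimes> x"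
    and T: "T = {i} \<times> (inv (P l i) <# H) \<times> {l}"
    by (auto simp: abelian_subgroup_of_iff)
  interpret H: subgroup H G by fact
  note p = P[OF l i]
  have T': "T = (\<lambda>h. (i, inv (P l i) \<otimes> h, l)) ` H"
    using T by (auto simp: l_coset_def)
  have mult: "smult (rees_matrix_semigroup G I L P)
      (i, inv (P l i) \<otimes> h, l) (i, inv (P l i) \<otimes> k, l) = (i, inv (P l i) \<otimes> (h \<otimes> k), l)"
    if "h \<in> H" "k \<in> H" for h k
    using that p by (intro smult_rees_block) auto
  have "T \<subseteq> I \<times> carrier G \<times> L"
    using i l p by (auto simp: T')
  moreover have "T \<noteq> {}"
    unfolding T' using H.one_closed by blast
  ultimately show "?comm T"
    unfolding comm_subsemigroup_def subsemigroup_def T'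
    by (auto simp: mult comm simp del: smult_rees_matrix_semigroup)
qed

end

theorem corollary3p5:
  fixes G :: "('a, 'b) monoid_scheme"
    and I :: "'i set" and L :: "'l set"
    and P :: "'l \<Rightarrow> 'i \<Rightarrow> 'a"
  assumes "group G" and "finite (carrier G)"
    and "finite I" and "I \<noteq> {}"
    and "finite L" and "L \<noteq> {}"
    and "\<And>l i. l \<in> L \<Longrightarrow> i \<in> I \<Longrightarrow> P l i \<in> carrier G"
  shows "Max {card T | T. comm_subsemigroup T (rees_matrix_semigroup G I L P)} =
      Max {card H | H. abelian_subgroup_of H G} \<and>
    {T. is_arg_max card (\<lambda>T. comm_subsemigroup T (rees_matrix_semigroup G I L P)) T} =
      {{i} \<times> (inv\<^bsub>G\<^esub> (P l i) <#\<^bsub>G\<^esub> H) \<times> {l} | i l H.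
        i \<in> I \<and> l \<in> L \<and> is_arg_max card (\<lambda>H. abelian_subgroup_of H G) H} \<and>
    (\<forall>i l H. i \<in> I \<and> l \<in> L \<and> is_arg_max card (\<lambda>H. abelian_subgroup_of H G) H \<longrightarrow>
      (\<exists>e. group (restrict_monoid (rees_matrix_semigroup G I L P)
        ({i} \<times> (inv\<^bsub>G\<^esub> (P l i) <#\<^bsub>G\<^esub> H) \<times> {l}) e)))"
proof -
  interpret group G by fact
  let ?M = "rees_matrix_semigroup G I L P"
  let ?block = "\<lambda>i l H. {i} \<times> (inv\<^bsub>G\<^esub> (P l i) <#\<^bsub>G\<^esub> H) \<times> {l}"
  have iff: "comm_subsemigroup T ?M \<longleftrightarrow>
      (\<exists>i\<in>I. \<exists>l\<in>L. \<exists>H. abelian_subgroup_of H G \<and> T = ?block i l H)" for T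
    using comm_subsemigroup_rees_matrix_semigroup_iff[OF assms(2)] assms(7) by blast
  have card_block: "card (?block i l H) = card H"
    if "i \<in> I" "l \<in> L" "abelian_subgroup_of H G" for i l H
    using that assms(7)
    by (intro card_rees_block) (auto simp: abelian_subgroup_of_def dest: subgroup.subset)
  obtain i0 l0 where i0: "i0 \<in> I" and l0: "l0 \<in> L"
    using assms(4,6) by blast
  \<comment> \<open>Since \<open>I\<close> and \<open>L\<close> are nonempty, every abelian subgroup occurs in some block, so the two
    families realise the same sizes.\<close>
  have cards: "(\<exists>T. n = card T \<and> comm_subsemigroup T ?M) \<longleftrightarrow>
      (\<exists>H. n = card H \<and> abelian_subgroup_of H G)" for n
  proof
    assume "\<exists>T. n = card T \<and> comm_subsemigroup T ?M"
    then show "\<exists>H. n = card H \<and> abelian_subgroup_of H G"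
      unfolding iff using card_block by auto
  next
    assume "\<exists>H. n = card H \<and> abelian_subgroup_of H G"
    then obtain H where H: "abelian_subgroup_of H G" "n = card H"
      by blast
    then have "comm_subsemigroup (?block i0 l0 H) ?M"
      unfolding iff using i0 l0 by blast
    then show "\<exists>T. n = card T \<and> comm_subsemigroup T ?M"
      using card_block[OF i0 l0 H(1)] H(2) by metis
  qed
  then have "{card T | T. comm_subsemigroup T ?M} = {card H | H. abelian_subgroup_of H G}"
    by (simp only:)
  moreover have arg_max: "is_arg_max card (\<lambda>T. comm_subsemigroup T ?M) (?block i l H) \<longleftrightarrow>
      is_arg_max card (\<lambda>H. abelian_subgroup_of H G) H"
    if il: "i \<in> I" "l \<in> L" and H: "abelian_subgroup_of H G" for i l H
  proof -
    have "comm_subsemigroup (?block i l H) ?M"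
      unfolding iff using il H by blast
    moreover have "(\<exists>T. comm_subsemigroup T ?M \<and> card T > n) \<longleftrightarrow>
        (\<exists>H. abelian_subgroup_of H G \<and> card H > n)" for n
      using cards by metis
    ultimately show ?thesis
      by (simp only: is_arg_max_def card_block[OF il H] H)
  qed
  have "{T. is_arg_max card (\<lambda>T. comm_subsemigroup T ?M) T} =
      {?block i l H | i l H.
        i \<in> I \<and> l \<in> L \<and> is_arg_max card (\<lambda>H. abelian_subgroup_of H G) H}" (is "?A = ?B")
  proof
    show "?A \<subseteq> ?B"
    proof
      fix T assume T: "T \<in> ?A"
      then have "comm_subsemigroup T ?M"
        by (simp add: is_arg_max_def)
      then obtain i l H where "i \<in> I" "l \<in> L" "abelian_subgroup_of H G" "T = ?block i l H"
        unfolding iff by blast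
      then show "T \<in> ?B"
        using T arg_max[of i l H] by blast
    qed
    show "?B \<subseteq> ?A"
      using arg_max by (auto simp: is_arg_max_def[of _ "\<lambda>H. abelian_subgroup_of H G"])
  qed
  moreover have "\<exists>e. group (restrict_monoid ?M (?block i l H) e)"
    if "i \<in> I" "l \<in> L" "is_arg_max card (\<lambda>H. abelian_subgroup_of H G) H" for i l H
  proof -
    have "subgroup H G"
      using that(3) by (simp add: is_arg_max_def abelian_subgroup_of_def)
    then show ?thesis
      using group_rees_block[of P l i H I L] that assms(7) by blast
  qed
  ultimately show ?thesis
    by simp
qed

end
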